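(* Let $k\ge 2$ and $n>2k$ be integers. Let $K$ be the simplicial complex (on vertex set $T_{n,n}$) whose collection of maximal simplices is \[M_{n,k}=\{\pi_n(\sigma) : \sigma \text{ is a maximal simplex of } \mathrm{VR}(\mathbb{Z}^2;k)\}.\] Then $K$ is homotopy equivalent to the torus $S^1\times S^1$. Consequently, when $k\ge 2$ and $n>3k$, the complex $\mathrm{VR}(T_{n,n};k)$ is homotopy equivalent to the torus $S^1\times S^1$.
   Context: $\mathbb{Z}^2$ carries the $l^1$ metric $d((x,y),(x',y'))=|x-x'|+|y-y'|$. For a metric space $X$ and $r\ge 0$, the Vietoris--Rips complex $\mathrm{VR}(X;r)$ is the simplicial complex on vertex set $X$ whose simplices are the finite nonempty subsets of diameter at most $r$. $T_{n,n}$ denotes the set $\{0,\dots,n-1\}^2$ with metric $d((i,j),(i',j'))=\min\{|i-i'|,n-|i-i'|\}+\min\{|j-j'|,n-|j-j'|\}$ (the shortest-path metric of the $n\times n$ torus grid graph $C_n\,\square\,C_n$); it is identified with the quotient $\mathbb{Z}^2/(n\mathbb{Z}\times n\mathbb{Z})$ with the quotient metric, and $\pi_n:\mathbb{Z}^2\to T_{n,n}$ is the reduction of both coordinates mod $n$. A maximal simplex (facet) is a simplex not properly contained in another simplex. *)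

theory Defs
  imports "HOL-Analysis.Analysis"
begin

definition l1_dist :: "int \<times> int \<Rightarrow> int \<times> int \<Rightarrow> int" where
  "l1_dist p q = \<bar>fst p - fst q\<bar> + \<bar>snd p - snd q\<bar>"

definition torus_pts :: "nat \<Rightarrow> (int \<times> int) set" where
  "torus_pts n = {0..<int n} \<times> {0..<int n}"

definition torus_dist :: "nat \<Rightarrow> int \<times> int \<Rightarrow> int \<times> int \<Rightarrow> int" where
  "torus_dist n p q =
     min \<bar>fst p - fst q\<bar> (int n - \<bar>fst p - fst q\<bar>)
   + min \<bar>snd p - snd q\<bar> (int n - \<bar>snd p - snd q\<bar>)"

definition pi_n :: "nat \<Rightarrow> int \<times> int \<Rightarrow> int \<times> int" where
  "pi_n n p = (fst p mod int n, snd p mod int n)"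

definition VR :: "'a set \<Rightarrow> ('a \<Rightarrow> 'a \<Rightarrow> int) \<Rightarrow> int \<Rightarrow> 'a set set" where
  "VR X d r = {\<sigma>. \<sigma> \<subseteq> X \<and> finite \<sigma> \<and> \<sigma> \<noteq> {} \<and> (\<forall>x\<in>\<sigma>. \<forall>y\<in>\<sigma>. d x y \<le> r)}"

definition maximal_simplex :: "'a set set \<Rightarrow> 'a set \<Rightarrow> bool" where
  "maximal_simplex K \<sigma> \<longleftrightarrow> \<sigma> \<in> K \<and> \<not> (\<exists>\<tau>\<in>K. \<sigma> \<subset> \<tau>)"

definition complex_generated :: "'a set set \<Rightarrow> 'a set set" where
  "complex_generated M = {\<tau>. \<tau> \<noteq> {} \<and> (\<exists>\<sigma>\<in>M. \<tau> \<subseteq> \<sigma>)}"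

definition M_nk :: "nat \<Rightarrow> nat \<Rightarrow> (int \<times> int) set set" where
  "M_nk n k = {pi_n n ` \<sigma> | \<sigma>. maximal_simplex (VR UNIV l1_dist (int k)) \<sigma>}"

text \<open>Geometric realization of a (finite) simplicial complex K with vertices in 'a,
  as the set of barycentric-coordinate functions, topologised as a subspace of
  the product space 'a \<Rightarrow> real.\<close>
definition geom_real :: "'a set set \<Rightarrow> ('a \<Rightarrow> real) set" where
  "geom_real K = {f. (\<forall>v. 0 \<le> f v) \<and> {v. f v \<noteq> 0} \<in> K \<and> sum f {v. f v \<noteq> 0} = 1}"

definition realization :: "'a set set \<Rightarrow> ('a \<Rightarrow> real) topology" where
  "realization K = top_of_set (geom_real K)"

definition torus_space :: "(complex \<times> complex) topology" where
  "torus_space = prod_topology (top_of_set (sphere 0 1)) (top_of_set (sphere 0 1))"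

end

theory Submission
  imports Defs
begin

text \<open>Since \<open>n > 2 k\<close>, the simplices of \<open>K\<close> are the images of the sets of diameter at most \<open>k\<close>, each of
  which lifts to the plane uniquely up to translation by \<open>n\<close> times a lattice vector; for \<open>n > 3 k\<close> the
  same is true of every simplex of the Vietoris--Rips complex of the torus grid.

  The homotopy equivalence is explicit. Let \<open>r = k / 2 + 1 / 4\<close>. As \<open>r > 1\<close>, every point \<open>z\<close> of the
  torus is at \<open>l\<^sup>1\<close> distance less than \<open>r\<close> from some vertices; as \<open>2 r < k + 1\<close>, these form a simplex
  \<open>box z\<close>. Weighting them by \<open>r\<close> minus the distance gives a map \<open>spread\<close> from the torus to \<open>|K|\<close>.
  Conversely, \<open>center\<close> sends a point of \<open>|K|\<close> to a continuous version of the midpoint of its support,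
  chosen so that all vertices of substantial weight remain within \<open>k / 2\<close> of it. After cutting
  off small weights, a point \<open>\<mu>\<close> of \<open>|K|\<close> is thus supported in the simplex \<open>box (center \<mu>)\<close>, which also
  carries \<open>spread (center \<mu>)\<close>, and linear homotopies connect \<open>spread \<circ> center\<close> to the identity. In the
  other direction, \<open>z\<close> and \<open>center (spread z)\<close> have a vertex in common in their boxes, so in each circle
  factor they are at distance less than \<open>2 r \<le> n / 2\<close>, hence not antipodal.\<close>

section \<open>Homotopies into the circle and into products\<close>

lemma homotopic_with_canon_iff:
  "homotopic_with_canon (\<lambda>_. True) S T f g \<longleftrightarrow>
     (\<exists>h. continuous_on ({0..1::real} \<times> S) h \<and> h \<in> {0..1} \<times> S \<rightarrow> T
        \<and> (\<forall>x\<in>S. h (0, x) = f x) \<and> (\<forall>x\<in>S. h (1, x) = g x))"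
  by (subst homotopic_with) (auto simp: prod_topology_subtopology_eu)

text \<open>The segment from \<open>f x\<close> to \<open>g x\<close> meets the origin only if the
  two unit vectors are opposite (comparing norms forces \<open>t = 1 / 2\<close>), so it can be
  projected radially to the sphere.\<close>

lemma homotopic_with_sphere_non_antipodal:
  fixes f g :: "'a::topological_space \<Rightarrow> 'b::real_normed_vector"
  assumes "continuous_on S f" "continuous_on S g" "f \<in> S \<rightarrow> sphere 0 1" "g \<in> S \<rightarrow> sphere 0 1"
    and non_antipodal: "\<And>x. x \<in> S \<Longrightarrow> f x \<noteq> - g x"
  shows "homotopic_with_canon (\<lambda>_. True) S (sphere 0 1) f g"
proof -
  define l where "l = (\<lambda>z :: real \<times> 'a. (1 - fst z) *\<^sub>R f (snd z) + fst z *\<^sub>R g (snd z))"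
  define h where "h = (\<lambda>z. l z /\<^sub>R norm (l z))"
  have l_nz: "l (t, x) \<noteq> 0" if "0 \<le> t" "t \<le> 1" "x \<in> S" for t x
  proof
    assume "l (t, x) = 0"
    then have eq: "(1 - t) *\<^sub>R f x = - (t *\<^sub>R g x)"
      by (simp add: l_def eq_neg_iff_add_eq_0)
    moreover have "norm (f x) = 1" "norm (g x) = 1"
      using assms that by auto
    ultimately have "1 - t = t"
      using that by (metis abs_of_nonneg diff_ge_0_iff_ge mult.right_neutral norm_minus_cancel norm_scaleR)
    then have "t = 1 / 2" by simp
    with eq have "(1 / 2) *\<^sub>R f x = (1 / 2) *\<^sub>R (- g x)" by simp
    then have "f x = - g x" by (simp only: scaleR_cancel_left) simp
    with non_antipodal that show False by blast
  qed
  have "continuous_on ({0..1} \<times> S) l"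
    unfolding l_def
    by (intro continuous_intros continuous_on_compose2[OF assms(1)] continuous_on_compose2[OF assms(2)]) auto
  then have "continuous_on ({0..1} \<times> S) h"
    unfolding h_def by (intro continuous_intros) (use l_nz in auto)
  moreover have "h \<in> ({0..1} \<times> S) \<rightarrow> sphere 0 1"
    using l_nz by (auto simp: h_def)
  moreover have "\<forall>x\<in>S. h (0, x) = f x" "\<forall>x\<in>S. h (1, x) = g x"
    using assms by (auto simp: h_def l_def Pi_iff)
  ultimately show ?thesis
    unfolding homotopic_with_canon_iff by blast
qed

lemma homotopic_with_canon_Pair:
  assumes "homotopic_with_canon (\<lambda>_. True) S T f f'" "homotopic_with_canon (\<lambda>_. True) S U g g'"
  shows "homotopic_with_canon (\<lambda>_. True) S (T \<times> U) (\<lambda>x. (f x, g x)) (\<lambda>x. (f' x, g' x))"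
proof -
  obtain h h' where h: "continuous_on ({0..1::real} \<times> S) h" "h \<in> {0..1} \<times> S \<rightarrow> T"
      "\<forall>x\<in>S. h (0, x) = f x" "\<forall>x\<in>S. h (1, x) = f' x"
    and h': "continuous_on ({0..1::real} \<times> S) h'" "h' \<in> {0..1} \<times> S \<rightarrow> U"
      "\<forall>x\<in>S. h' (0, x) = g x" "\<forall>x\<in>S. h' (1, x) = g' x"
    using assms unfolding homotopic_with_canon_iff by blast
  show ?thesis
    unfolding homotopic_with_canon_iff
    by (rule exI[of _ "\<lambda>z. (h z, h' z)"])
      (use h h' in \<open>auto intro: continuous_on_Pair simp: Pi_iff\<close>)
qed

section \<open>Simplices of the generated complex as images of plane sets of bounded
  diameter\<close>

lemma finite_l1_ball: "finite {q. l1_dist p q \<le> r}"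
proof (rule finite_subset)
  show "{q. l1_dist p q \<le> r} \<subseteq> {fst p - r..fst p + r} \<times> {snd p - r..snd p + r}"
    by (auto simp: l1_dist_def)
qed auto

text \<open>All simplices containing \<sigma> lie in one finite ball around a point of \<sigma>, so
  there are finitely many; one that is maximal among them is maximal outright.\<close>

lemma maximal_simplex_VR_extend:
  assumes "\<sigma> \<in> VR UNIV l1_dist r"
  shows "\<exists>\<tau>. maximal_simplex (VR UNIV l1_dist r) \<tau> \<and> \<sigma> \<subseteq> \<tau>"
proof -
  obtain p where p: "p \<in> \<sigma>" using assms by (auto simp: VR_def)
  define \<C> where "\<C> = {\<tau> \<in> VR UNIV l1_dist r. \<sigma> \<subseteq> \<tau>}"
  have "\<C> \<subseteq> Pow {q. l1_dist p q \<le> r}"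
    using p by (auto simp: \<C>_def VR_def)
  then have "finite \<C>" using finite_l1_ball finite_subset by blast
  moreover have "\<C> \<noteq> {}" using assms by (auto simp: \<C>_def)
  ultimately obtain \<tau> where \<tau>: "\<tau> \<in> \<C>" "\<And>\<rho>. \<rho> \<in> \<C> \<Longrightarrow> \<tau> \<subseteq> \<rho> \<Longrightarrow> \<tau> = \<rho>"
    using finite_has_maximal by metis
  then show ?thesis
    unfolding maximal_simplex_def \<C>_def by blast
qed

lemma complex_generated_M_nk_iff:
  "\<tau> \<in> complex_generated (M_nk n k) \<longleftrightarrow> (\<exists>\<sigma>\<in>VR UNIV l1_dist (int k). \<tau> = pi_n n ` \<sigma>)"
proof
  assume "\<tau> \<in> complex_generated (M_nk n k)"
  then obtain \<sigma> where \<sigma>: "\<tau> \<noteq> {}" "\<sigma> \<in> VR UNIV l1_dist (int k)" "\<tau> \<subseteq> pi_n n ` \<sigma>"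
    by (auto simp: complex_generated_def M_nk_def maximal_simplex_def)
  then have "\<tau> = pi_n n ` (\<sigma> \<inter> pi_n n -` \<tau>)" by auto
  moreover have "\<sigma> \<inter> pi_n n -` \<tau> \<noteq> {}" using calculation \<sigma>(1) by blast
  then have "\<sigma> \<inter> pi_n n -` \<tau> \<in> VR UNIV l1_dist (int k)"
    using \<sigma>(2) by (auto simp: VR_def)
  ultimately show "\<exists>\<sigma>\<in>VR UNIV l1_dist (int k). \<tau> = pi_n n ` \<sigma>" by blast
next
  assume "\<exists>\<sigma>\<in>VR UNIV l1_dist (int k). \<tau> = pi_n n ` \<sigma>"
  then obtain \<sigma> where \<sigma>: "\<sigma> \<in> VR UNIV l1_dist (int k)" "\<tau> = pi_n n ` \<sigma>" by blast
  obtain \<rho> where "maximal_simplex (VR UNIV l1_dist (int k)) \<rho>" "\<sigma> \<subseteq> \<rho>"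
    using maximal_simplex_VR_extend[OF \<sigma>(1)] by blast
  moreover have "\<tau> \<noteq> {}" using \<sigma> by (auto simp: VR_def)
  ultimately show "\<tau> \<in> complex_generated (M_nk n k)"
    using \<sigma>(2) unfolding complex_generated_def M_nk_def by blast
qed

lemma pi_n_eq_iff: 
  "pi_n n p = pi_n n q \<longleftrightarrow> (\<exists>a b. fst p = fst q + int n * a \<and> snd p = snd q + int n * b)"
  by (auto simp: pi_n_def mod_eq_dvd_iff dvd_def algebra_simps)

lemma pi_n_in_torus_pts: "n > 0 \<Longrightarrow> pi_n n p \<in> torus_pts n"
  by (auto simp: pi_n_def torus_pts_def)

lemma pi_n_idem: "p \<in> torus_pts n \<Longrightarrow> pi_n n p = p"
  by (cases p) (auto simp: pi_n_def torus_pts_def)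

section \<open>The circle of circumference \<open>n\<close> and distances to its integer
  points\<close>

definition circ :: "nat \<Rightarrow> real \<Rightarrow> complex" where
  "circ n a = cis (2 * pi * a / real n)"

text \<open>Arc length from \<open>z\<close> to the grid point \<open>i\<close>, scaled so that the
  whole circle has length \<open>n\<close>; the arccosine is the angle between the two unit
  vectors.\<close>

definition circ_dist :: "nat \<Rightarrow> complex \<Rightarrow> int \<Rightarrow> real" where
  "circ_dist n z i = real n / (2 * pi) * arccos (Re (z * cnj (circ n (of_int i))))"

lemma circ_mult_cnj: "Re (circ n a * cnj (circ n b)) = cos (2 * pi * (a - b) / real n)"
  by (simp add: circ_def cis_cnj cis_mult diff_divide_distrib ring_distribs)

lemma arccos_cos_le_abs: "arccos (cos x) \<le> \<bar>x\<bar>"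
proof (cases "\<bar>x\<bar> \<le> pi")
  case True then show ?thesis by (simp add: arccos_cos_eq_abs)
next
  case False then show ?thesis using arccos_ubound[of "cos x"] by simp
qed

lemma cos_circ_shift:
  assumes "n > 0"
  shows "cos (2 * pi * (a - of_int (i + int n * m)) / real n) = cos (2 * pi * (a - of_int i) / real n)"
proof -
  have "2 * pi * (a - of_int (i + int n * m)) / real n = 2 * pi * (a - of_int i) / real n - 2 * pi * of_int m"
    using assms by (simp add: field_simps)
  then show ?thesis by (simp add: cos_diff)
qed

lemma circ_shift:
  assumes "n > 0"
  shows "circ n (a + real n * of_int m) = circ n a"
proof -
  have "2 * pi * (a + real n * of_int m) / real n = 2 * pi * a / real n + 2 * pi * of_int m"
    using assms by (simp add: field_simps)
  then show ?thesis unfolding circ_def by (simp add: cis_mult[symmetric] cis_multiple_2pi)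
qed

text \<open>With \<open>circ_dist_attained\<close>, this makes \<open>circ_dist\<close> the quotient
  distance: the minimum of \<open>\<bar>a - j\<bar>\<close> over all \<open>j\<close> in the residue
  class.\<close>

lemma circ_dist_le:
  assumes "n > 0"
  shows "circ_dist n (circ n a) (j mod int n) \<le> \<bar>a - of_int j\<bar>"
proof -
  have j: "j = j mod int n + int n * (j div int n)" by simp
  have "arccos (cos (2 * pi * (a - of_int (j mod int n)) / real n))
      = arccos (cos (2 * pi * (a - of_int j) / real n))"
    using cos_circ_shift[OF assms, of a "j mod int n" "j div int n"] j by simp
  also have "\<dots> \<le> \<bar>2 * pi * (a - of_int j) / real n\<bar>" by (rule arccos_cos_le_abs)
  also have "\<dots> = 2 * pi / real n * \<bar>a - of_int j\<bar>" by (simp add: abs_mult)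
  finally show ?thesis using assms unfolding circ_dist_def circ_mult_cnj
    by (simp add: field_simps)
qed

lemma circ_dist_attained:
  assumes "n > 0" "i \<in> {0..<int n}"
  obtains j where "j mod int n = i" "circ_dist n (circ n a) i = \<bar>a - of_int j\<bar>"
proof
  \<comment> \<open>Rounding picks the member \<open>j\<close> of the class nearest to
    \<open>a\<close>. Then \<open>\<bar>a - j\<bar>\<close> is at most \<open>n / 2\<close>, so the
    angle lies in the range where arccos inverts cos up to sign.\<close>
  define m where "m = round ((a - of_int i) / real n)"
  define j where "j = i + int n * m"
  show "j mod int n = i" using assms by (simp add: j_def)
  have "\<bar>of_int m - (a - of_int i) / real n\<bar> \<le> 1 / 2"
    unfolding m_def by (rule of_int_round_abs_le)
  then have "\<bar>a - of_int j\<bar> \<le> real n / 2"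
    using assms by (subst abs_minus_commute) (simp add: j_def field_simps)
  then have "\<bar>2 * pi * (a - of_int j) / real n\<bar> \<le> pi"
    using assms by (simp add: abs_mult divide_le_eq)
  then have "arccos (cos (2 * pi * (a - of_int j) / real n)) = 2 * pi / real n * \<bar>a - of_int j\<bar>"
    by (simp add: arccos_cos_eq_abs abs_mult)
  then show "circ_dist n (circ n a) i = \<bar>a - of_int j\<bar>"
    using assms cos_circ_shift[of n a i m] unfolding circ_dist_def circ_mult_cnj j_def
    by simp
qed

text \<open>A grid point splits the half circle between antipodes, as arccos x + arccos (-x) = pi.
  Hence two points whose distances to a common grid point add up to less than \<open>n / 2\<close>
  are not antipodal.\<close>

lemma circ_dist_sum_antipodal:
  assumes "n > 0" "norm z = 1"
  shows "circ_dist n z i + circ_dist n (- z) i = real n / 2"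
proof -
  have "\<bar>Re (z * cnj (circ n (of_int i)))\<bar> \<le> 1"
    using assms abs_Re_le_cmod[of "z * cnj (circ n (of_int i))"] by (simp add: norm_mult circ_def)
  then have "arccos (Re (z * cnj (circ n (of_int i)))) + arccos (- Re (z * cnj (circ n (of_int i)))) = pi"
    by (simp add: arccos_minus abs_le_iff del: times_complex.sel)
  then show ?thesis
    using assms unfolding circ_dist_def mult_minus_left uminus_complex.sel
    by (simp flip: distrib_left add_divide_distrib del: times_complex.sel)
qed

lemma circ_surj:
  assumes "n > 0" "norm z = 1"
  obtains a where "z = circ n a"
proof
  have "z = cis (Arg z)" using assms by (metis cis_Arg norm_eq_zero sgn_eq one_neq_zero div_by_1 of_real_1)
  then show "z = circ n (real n * Arg z / (2 * pi))" using assms by (simp add: circ_def)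
qed

lemma continuous_on_circ_dist: "continuous_on (sphere 0 1) (\<lambda>z. circ_dist n z i)"
proof -
  have "-1 \<le> Re (z * cnj (circ n (of_int i))) \<and> Re (z * cnj (circ n (of_int i))) \<le> 1"
    if "norm z = 1" for z
    using that abs_Re_le_cmod[of "z * cnj (circ n (of_int i))"]
    by (simp add: norm_mult circ_def abs_le_iff del: times_complex.sel)
  then show ?thesis unfolding circ_dist_def
    by (intro continuous_intros) (simp_all del: times_complex.sel)
qed

section \<open>Normalized weights and linear homotopies in a realization\<close>

lemma continuous_on_Max_image:
  fixes f :: "'i \<Rightarrow> 'a::topological_space \<Rightarrow> real"
  assumes "finite I" "I \<noteq> {}" "\<And>i. i \<in> I \<Longrightarrow> continuous_on S (f i)"
  shows "continuous_on S (\<lambda>x. Max ((\<lambda>i. f i x) ` I))"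
  using assms
proof (induction rule: finite_ne_induct)
  case (insert i I)
  then have "continuous_on S (\<lambda>x. max (f i x) (Max ((\<lambda>i. f i x) ` I)))"
    by (intro continuous_intros) auto
  then show ?case using insert by simp
qed simp

lemma sum_support:
  assumes "finite A" "{v. f v \<noteq> 0} \<subseteq> A"
  shows "sum f {v. f v \<noteq> 0} = sum f A"
  using assms by (intro sum.mono_neutral_left) auto

text \<open>Summing over a fixed set \<open>A\<close>, not over the support, which varies with the
  point, keeps continuity a coordinatewise matter.\<close>

definition normalize_on :: "'a set \<Rightarrow> ('a \<Rightarrow> real) \<Rightarrow> 'a \<Rightarrow> real" where
  "normalize_on A g v = g v / sum g A"

lemma
  assumes "finite A" "\<And>v. 0 \<le> g v" "{v. g v \<noteq> 0} \<subseteq> A" "{v. g v \<noteq> 0} \<noteq> {}"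
  shows sum_support_pos: "0 < sum g A"
    and support_normalize_on: "{v. normalize_on A g v \<noteq> 0} = {v. g v \<noteq> 0}"
    and normalize_on_in_geom_real: "{v. g v \<noteq> 0} \<in> K \<Longrightarrow> normalize_on A g \<in> geom_real K"
proof -
  obtain v where "g v \<noteq> 0" using assms(4) by blast
  then have "v \<in> A" "g v > 0" using assms(2)[of v] assms(3) by auto
  then show pos: "0 < sum g A" using assms by (intro sum_pos2) auto
  then show supp: "{v. normalize_on A g v \<noteq> 0} = {v. g v \<noteq> 0}" by (simp add: normalize_on_def)
  have "sum (normalize_on A g) {v. g v \<noteq> 0} = sum (normalize_on A g) A"
    using assms by (intro sum.mono_neutral_left) (auto simp: normalize_on_def)
  also have "\<dots> = 1" using pos by (simp add: normalize_on_def flip: sum_divide_distrib)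
  finally show "normalize_on A g \<in> geom_real K" if "{v. g v \<noteq> 0} \<in> K"
    using that supp pos assms(2) by (simp add: geom_real_def) (simp add: normalize_on_def)
qed

lemma continuous_on_normalize_on:
  assumes "\<And>v. continuous_on S (\<lambda>x. g x v)" "\<And>x. x \<in> S \<Longrightarrow> sum (g x) A \<noteq> 0"
  shows "continuous_on S (\<lambda>x. normalize_on A (g x))"
  unfolding normalize_on_def using assms by (intro continuous_intros) auto

lemma continuous_on_apply: "continuous_on S (\<lambda>f :: 'a \<Rightarrow> 'b::topological_space. f v)"
  using continuous_on_product_then_coordinatewise[OF continuous_on_id] .

locale abstract_complex =
  fixes K :: "'a set set"
  assumes finite_simplex: "\<sigma> \<in> K \<Longrightarrow> finite \<sigma>"
    and face_closed: "\<sigma> \<in> K \<Longrightarrow> \<tau> \<subseteq> \<sigma> \<Longrightarrow> \<tau> \<noteq> {} \<Longrightarrow> \<tau> \<in> K"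
begin

text \<open>The support of the combination stays inside \<tau> and is nonempty because the weights
  still sum to 1, so it is a face of \<tau>.\<close>

lemma geom_real_convex_combination:
  assumes "f \<in> geom_real K" "g \<in> geom_real K"
    and "\<tau> \<in> K" "{v. f v \<noteq> 0} \<subseteq> \<tau>" "{v. g v \<noteq> 0} \<subseteq> \<tau>" and t: "0 \<le> t" "t \<le> 1"
  shows "(\<lambda>v. (1 - t) * f v + t * g v) \<in> geom_real K"
proof -
  let ?h = "\<lambda>v. (1 - t) * f v + t * g v"
  have fin: "finite \<tau>" using assms finite_simplex by blast
  have "sum f \<tau> = 1" "sum g \<tau> = 1"
    using assms(1,2) sum_support[OF fin assms(4)] sum_support[OF fin assms(5)]
    by (simp_all add: geom_real_def)
  then have sum_h: "sum ?h \<tau> = 1" by (simp add: sum.distrib flip: sum_distrib_left)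
  have "f v = 0 \<and> g v = 0" if "v \<notin> \<tau>" for v using assms(4,5) that by blast
  then have sub: "{v. ?h v \<noteq> 0} \<subseteq> \<tau>" by force
  then have "sum ?h {v. ?h v \<noteq> 0} = 1"
    using sum_support[OF fin, of ?h] sum_h by simp
  moreover from this have "{v. ?h v \<noteq> 0} \<noteq> {}" by (metis sum.empty zero_neq_one)
  with sub assms have "{v. ?h v \<noteq> 0} \<in> K" using face_closed by blast
  moreover have "0 \<le> ?h v" for v using assms by (simp add: geom_real_def)
  ultimately show ?thesis by (simp add: geom_real_def)
qed

text \<open>The straight-line homotopy works: each segment stays in a closed simplex, and in the
  product topology continuity can be checked per coordinate.\<close>

lemma homotopic_with_contiguous:
  assumes "continuous_on S f" "continuous_on S g" "f \<in> S \<rightarrow> geom_real K" "g \<in> S \<rightarrow> geom_real K"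
    and "\<And>x. x \<in> S \<Longrightarrow> \<exists>\<tau>\<in>K. {v. f x v \<noteq> 0} \<subseteq> \<tau> \<and> {v. g x v \<noteq> 0} \<subseteq> \<tau>"
  shows "homotopic_with_canon (\<lambda>_. True) S (geom_real K) f g"
  unfolding homotopic_with_canon_iff
proof (intro exI conjI)
  let ?h = "\<lambda>z. \<lambda>v. (1 - fst z) * f (snd z) v + fst z * g (snd z) v"
  have "continuous_on S (\<lambda>x. f x v)" "continuous_on S (\<lambda>x. g x v)" for v
    by (rule continuous_on_product_then_coordinatewise[OF assms(1)],
        rule continuous_on_product_then_coordinatewise[OF assms(2)])
  then show "continuous_on ({0..1} \<times> S) ?h"
    by (intro continuous_on_coordinatewise_then_product continuous_intros
        continuous_on_compose2[of S "\<lambda>x. f x _" _ snd] continuous_on_compose2[of S "\<lambda>x. g x _" _ snd]) auto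
  show "?h \<in> {0..1} \<times> S \<rightarrow> geom_real K"
  proof
    fix z :: "real \<times> _" assume z: "z \<in> {0..1} \<times> S"
    then obtain \<tau> where "\<tau> \<in> K" "{v. f (snd z) v \<noteq> 0} \<subseteq> \<tau>" "{v. g (snd z) v \<noteq> 0} \<subseteq> \<tau>"
      using assms(5)[of "snd z"] by auto
    then show "?h z \<in> geom_real K"
      using z assms(3,4) by (intro geom_real_convex_combination) auto
  qed
qed auto

end

text \<open>Shifting by \<open>n div 2\<close> before and after \<open>mod\<close> selects the
  residue in a window of length \<open>n\<close> around 0; \<open>2 * k < n\<close> places all of
  \<open>-k..k\<close> inside that window.\<close>

lemma mod_shift_eq_of_abs_le:
  fixes s t :: int and n k :: nat
  assumes "2 * k < n" "\<bar>t\<bar> \<le> int k" "s = t + int n * m"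
  shows "(s + int n div 2) mod int n - int n div 2 = t"
proof -
  have "(s + int n div 2) mod int n = (t + int n div 2) mod int n"
    using mod_mult_self2[of "t + int n div 2" "int n" m] assms(3) by (simp only: add_ac)
  also have "\<dots> = t + int n div 2"
    using assms by (intro mod_pos_pos_trivial) linarith+
  finally show ?thesis by simp
qed

locale torus_grid =
  fixes n k :: nat
  assumes k_ge: "2 \<le> k" and n_gt: "2 * k < n"
begin

abbreviation K :: "(int \<times> int) set set" where
  "K \<equiv> complex_generated (M_nk n k)"

lemma n_pos: "0 < n" using n_gt by simp

lemma simplex_subset: "\<tau> \<in> K \<Longrightarrow> \<tau> \<subseteq> torus_pts n"
  using pi_n_in_torus_pts[OF n_pos] unfolding complex_generated_M_nk_iff by auto

lemma finite_torus_pts: "finite (torus_pts n)"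
  by (simp add: torus_pts_def)

sublocale abstract_complex K
proof
  show "finite \<sigma>" if "\<sigma> \<in> K" for \<sigma>
    using simplex_subset[OF that] finite_torus_pts finite_subset by blast
  show "\<tau> \<in> K" if "\<sigma> \<in> K" "\<tau> \<subseteq> \<sigma>" "\<tau> \<noteq> {}" for \<sigma> \<tau>
    using that unfolding complex_generated_def by blast
qed

lemma geom_realD:
  assumes "\<mu> \<in> geom_real K"
  shows "0 \<le> \<mu> v" "{v. \<mu> v \<noteq> 0} \<in> K" "{v. \<mu> v \<noteq> 0} \<subseteq> torus_pts n" "{v. \<mu> v \<noteq> 0} \<noteq> {}"
    "sum \<mu> (torus_pts n) = 1"
proof -
  show "0 \<le> \<mu> v" and K: "{v. \<mu> v \<noteq> 0} \<in> K"
    using assms unfolding geom_real_def by blast+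
  then show "{v. \<mu> v \<noteq> 0} \<noteq> {}"
    unfolding complex_generated_def by blast
  from K show "{v. \<mu> v \<noteq> 0} \<subseteq> torus_pts n" by (rule simplex_subset)
  then show "sum \<mu> (torus_pts n) = 1"
    using assms sum_support[OF finite_torus_pts, of \<mu>] by (simp add: geom_real_def)
qed

section \<open>The map from the torus to the realization\<close>

definition radius :: real where
  "radius = real k / 2 + 1 / 4"

definition bump :: "complex \<times> complex \<Rightarrow> int \<times> int \<Rightarrow> real" where
  "bump z v = (if v \<in> torus_pts n
     then max 0 (radius - circ_dist n (fst z) (fst v) - circ_dist n (snd z) (snd v)) else 0)"

definition box :: "complex \<times> complex \<Rightarrow> (int \<times> int) set" where
  "box z = {v \<in> torus_pts n. circ_dist n (fst z) (fst v) + circ_dist n (snd z) (snd v) < radius}"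

lemma support_bump: "{v. bump z v \<noteq> 0} = box z"
  by (auto simp: bump_def box_def max_def)

lemma box_circ:
  "box (circ n a, circ n b) = pi_n n ` {p. \<bar>a - of_int (fst p)\<bar> + \<bar>b - of_int (snd p)\<bar> < radius}"
    (is "_ = pi_n n ` ?\<sigma>")
proof (intro equalityI subsetI)
  fix v assume "v \<in> box (circ n a, circ n b)"
  then have v: "fst v \<in> {0..<int n}" "snd v \<in> {0..<int n}"
      "circ_dist n (circ n a) (fst v) + circ_dist n (circ n b) (snd v) < radius"
    by (auto simp: box_def torus_pts_def)
  obtain i where i: "i mod int n = fst v" "circ_dist n (circ n a) (fst v) = \<bar>a - of_int i\<bar>"
    using circ_dist_attained[OF n_pos v(1)] by metis
  obtain j where j: "j mod int n = snd v" "circ_dist n (circ n b) (snd v) = \<bar>b - of_int j\<bar>"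
    using circ_dist_attained[OF n_pos v(2)] by metis
  have "v = pi_n n (i, j)" using i(1) j(1) by (simp add: pi_n_def prod_eq_iff)
  then show "v \<in> pi_n n ` ?\<sigma>" using v(3) i(2) j(2) by (intro image_eqI[of _ _ "(i, j)"]) auto
next
  fix v assume "v \<in> pi_n n ` ?\<sigma>"
  then obtain p where p: "v = pi_n n p" "p \<in> ?\<sigma>" by blast
  have "circ_dist n (circ n a) (fst v) \<le> \<bar>a - of_int (fst p)\<bar>"
    "circ_dist n (circ n b) (snd v) \<le> \<bar>b - of_int (snd p)\<bar>"
    using circ_dist_le[OF n_pos] p(1) by (simp_all add: pi_n_def)
  then show "v \<in> box (circ n a, circ n b)"
    using p pi_n_in_torus_pts[OF n_pos, of p] by (auto simp: box_def)
qed

lemma box_in_K: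
  assumes "z \<in> sphere 0 1 \<times> sphere 0 1"
  shows "box z \<in> K"
proof -
  have "norm (fst z) = 1" "norm (snd z) = 1" using assms by auto
  then obtain a b where "fst z = circ n a" "snd z = circ n b" using circ_surj[OF n_pos] by metis
  then have z: "z = (circ n a, circ n b)" by (simp add: prod_eq_iff)
  define \<sigma> where "\<sigma> = {p :: int \<times> int. \<bar>a - of_int (fst p)\<bar> + \<bar>b - of_int (snd p)\<bar> < radius}"
  have "l1_dist p q \<le> int k" if "p \<in> \<sigma>" "q \<in> \<sigma>" for p q
  proof -
    have "real_of_int (l1_dist p q)
        = \<bar>real_of_int (fst p) - real_of_int (fst q)\<bar> + \<bar>real_of_int (snd p) - real_of_int (snd q)\<bar>"
      by (simp add: l1_dist_def)
    also have "\<dots> < 2 * radius"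
      using that unfolding \<sigma>_def mem_Collect_eq by linarith
    \<comment> \<open>\<open>2 * radius\<close> equals \<open>k + 1 / 2\<close>, and the distance is
      an integer.\<close>
    finally show ?thesis by (simp add: radius_def)
  qed
  note diam = this
  \<comment> \<open>Nonemptiness: rounding costs at most 1/2 per coordinate, in total at most 1,
    which is below \<open>radius\<close> because \<open>k\<close> is at least 2.\<close>
  have "(round a, round b) \<in> \<sigma>"
    using of_int_round_abs_le[of a] of_int_round_abs_le[of b] k_ge
    by (simp add: \<sigma>_def radius_def abs_minus_commute)
  moreover from this have "\<sigma> \<subseteq> {q. l1_dist (round a, round b) q \<le> int k}" using diam by blast
  then have "finite \<sigma>" using finite_l1_ball finite_subset by blast
  ultimately have "\<sigma> \<in> VR UNIV l1_dist (int k)" using diam by (auto simp: VR_def)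
  moreover have "box z = pi_n n ` \<sigma>"
    unfolding z \<sigma>_def by (rule box_circ)
  ultimately show ?thesis unfolding complex_generated_M_nk_iff by blast
qed

lemma not_antipodal_of_common_box:
  assumes "v \<in> box z" "v \<in> box z'" "z \<in> sphere 0 1 \<times> sphere 0 1" "z' \<in> sphere 0 1 \<times> sphere 0 1"
  shows "fst z \<noteq> - fst z'" "snd z \<noteq> - snd z'"
proof -
  have nonneg: "0 \<le> circ_dist n w i" if "norm w = 1" for w i
    using that n_pos arccos_lbound abs_Re_le_cmod[of "w * cnj (circ n (of_int i))"]
    by (simp add: circ_dist_def norm_mult circ_def abs_le_iff del: times_complex.sel)
  \<comment> \<open>This reads \<open>k + 1 / 2 \<le> n / 2\<close>, that is
    \<open>2 * k + 1 \<le> n\<close>, which is \<open>2 * k < n\<close> for integers.\<close>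
  have "2 * radius \<le> real n / 2" using n_gt by (simp add: radius_def)
  then have "circ_dist n (fst z) (fst v) + circ_dist n (fst z') (fst v) < real n / 2"
    "circ_dist n (snd z) (snd v) + circ_dist n (snd z') (snd v) < real n / 2"
    using assms nonneg[of "fst z" "fst v"] nonneg[of "snd z" "snd v"]
      nonneg[of "fst z'" "fst v"] nonneg[of "snd z'" "snd v"] by (auto simp: box_def)
  then show "fst z \<noteq> - fst z'" "snd z \<noteq> - snd z'"
    using circ_dist_sum_antipodal[OF n_pos, of "fst z'" "fst v"]
      circ_dist_sum_antipodal[OF n_pos, of "snd z'" "snd v"] assms
    by (auto simp: add.commute)
qed

definition spread :: "complex \<times> complex \<Rightarrow> int \<times> int \<Rightarrow> real" where
  "spread z = normalize_on (torus_pts n) (bump z)"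

lemma
  assumes "z \<in> sphere 0 1 \<times> sphere 0 1"
  shows spread_in_geom_real: "spread z \<in> geom_real K"
    and support_spread: "{v. spread z v \<noteq> 0} = box z"
    and sum_bump_pos: "0 < sum (bump z) (torus_pts n)"
proof -
  have "box z \<in> K" by (rule box_in_K[OF assms])
  moreover from this have "box z \<noteq> {}" unfolding complex_generated_def by blast
  ultimately have *: "finite (torus_pts n)" "\<And>v. 0 \<le> bump z v" "{v. bump z v \<noteq> 0} \<subseteq> torus_pts n"
    "{v. bump z v \<noteq> 0} \<noteq> {}" "{v. bump z v \<noteq> 0} \<in> K"
    unfolding support_bump using finite_torus_pts simplex_subset by (auto simp: bump_def)
  show "spread z \<in> geom_real K" "0 < sum (bump z) (torus_pts n)"
    unfolding spread_def using normalize_on_in_geom_real[OF *] sum_support_pos[OF *(1-4)] by blast+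
  show "{v. spread z v \<noteq> 0} = box z"
    unfolding spread_def support_bump[symmetric] by (rule support_normalize_on[OF *(1-4)])
qed

lemma continuous_on_spread: "continuous_on (sphere 0 1 \<times> sphere 0 1) spread"
proof -
  have "continuous_on (sphere 0 1 \<times> sphere 0 1) (\<lambda>z. bump z v)" for v
    unfolding bump_def
    by (cases "v \<in> torus_pts n")
      (auto intro!: continuous_intros continuous_on_compose2[OF continuous_on_circ_dist])
  then show ?thesis
    unfolding spread_def using sum_bump_pos
    by (intro continuous_on_normalize_on) (auto simp: less_le)
qed

section \<open>Cutting off small weights, and soft maxima over the support\<close>

text \<open>Half of the average weight over the \<open>n ^ 2\<close> vertices, so weights that sum
  to 1 cannot all be at or below it.\<close>

definition threshold :: real where
  "threshold = 1 / (2 * real n ^ 2)"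

lemma threshold_pos: "0 < threshold"
  using n_pos by (simp add: threshold_def)

lemma ex_heavy:
  assumes "\<mu> \<in> geom_real K"
  obtains v where "v \<in> torus_pts n" "threshold < \<mu> v"
proof (rule ccontr)
  assume "\<not> thesis"
  then have "sum \<mu> (torus_pts n) \<le> (\<Sum>v\<in>torus_pts n. threshold)"
    using that by (intro sum_mono) force
  also have "\<dots> = 1 / 2"
    using n_pos by (simp add: threshold_def torus_pts_def power2_eq_square)
  finally show False using geom_realD(5)[OF assms] by simp
qed

definition truncate :: "(int \<times> int \<Rightarrow> real) \<Rightarrow> int \<times> int \<Rightarrow> real" where
  "truncate \<mu> = normalize_on (torus_pts n) (\<lambda>v. max 0 (\<mu> v - threshold))"

lemma
  assumes "\<mu> \<in> geom_real K"
  shows truncate_in_geom_real: "truncate \<mu> \<in> geom_real K"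
    and support_truncate: "{v. truncate \<mu> v \<noteq> 0} = {v. threshold < \<mu> v}"
    and sum_truncate_pos: "0 < sum (\<lambda>v. max 0 (\<mu> v - threshold)) (torus_pts n)"
proof -
  let ?g = "\<lambda>v. max 0 (\<mu> v - threshold)"
  have supp: "{v. ?g v \<noteq> 0} = {v. threshold < \<mu> v}" by (auto simp: max_def)
  moreover have "{v. threshold < \<mu> v} \<noteq> {}" using ex_heavy[OF assms] by blast
  moreover have "{v. threshold < \<mu> v} \<subseteq> {v. \<mu> v \<noteq> 0}" using threshold_pos by auto
  ultimately have *: "finite (torus_pts n)" "\<And>v. 0 \<le> ?g v" "{v. ?g v \<noteq> 0} \<subseteq> torus_pts n"
    "{v. ?g v \<noteq> 0} \<noteq> {}" "{v. ?g v \<noteq> 0} \<in> K"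
    using finite_torus_pts geom_realD[OF assms] face_closed[of "{v. \<mu> v \<noteq> 0}"] by auto
  show "truncate \<mu> \<in> geom_real K" "0 < sum ?g (torus_pts n)"
    unfolding truncate_def using normalize_on_in_geom_real[OF *] sum_support_pos[OF *(1-4)] by blast+
  show "{v. truncate \<mu> v \<noteq> 0} = {v. threshold < \<mu> v}"
    unfolding truncate_def supp[symmetric] using support_normalize_on[OF *(1-4)] .
qed

lemma continuous_on_truncate: "continuous_on (geom_real K) truncate"
  unfolding truncate_def using sum_truncate_pos
  by (intro continuous_on_normalize_on continuous_intros continuous_on_apply) (auto simp: less_le)

text \<open>Truncation only shrinks the support, so \<mu> and its truncation share the simplex that
  supports \<mu>.\<close>

lemma homotopic_id_truncate:
  "homotopic_with_canon (\<lambda>_. True) (geom_real K) (geom_real K) id truncate"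
proof (rule homotopic_with_contiguous)
  show "\<exists>\<tau>\<in>K. {v. id \<mu> v \<noteq> 0} \<subseteq> \<tau> \<and> {v. truncate \<mu> v \<noteq> 0} \<subseteq> \<tau>" if "\<mu> \<in> geom_real K" for \<mu>
    using geom_realD(2)[OF that] threshold_pos support_truncate[OF that]
    by (intro bexI[of _ "{v. \<mu> v \<noteq> 0}"]) auto
qed (auto simp: continuous_on_truncate truncate_in_geom_real)

text \<open>A continuous substitute for the maximum of \<open>\<phi>\<close> over the support of \<open>\<mu>\<close>: vertices of weight above
  the threshold count fully, vertices outside the support are penalised below all others.\<close>

definition soft_max :: "(int \<times> int \<Rightarrow> real) \<Rightarrow> (int \<times> int \<Rightarrow> real) \<Rightarrow> real" where
  "soft_max \<phi> \<mu> = Max ((\<lambda>v. \<phi> v - 4 * real n * max 0 (1 - \<mu> v / threshold)) ` torus_pts n)"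

lemma continuous_on_soft_max: "continuous_on S (soft_max \<phi>)"
  unfolding soft_max_def
  using finite_torus_pts n_pos threshold_pos
  by (intro continuous_on_Max_image continuous_intros continuous_on_apply) (auto simp: torus_pts_def)

lemma soft_max_ge:
  assumes "v \<in> torus_pts n" "threshold < \<mu> v"
  shows "\<phi> v \<le> soft_max \<phi> \<mu>"
proof -
  have "\<phi> v = \<phi> v - 4 * real n * max 0 (1 - \<mu> v / threshold)"
    using assms(2) threshold_pos by (simp add: max_def)
  also have "\<dots> \<le> soft_max \<phi> \<mu>"
    unfolding soft_max_def using assms(1) finite_torus_pts by (intro Max_ge) auto
  finally show ?thesis .
qed

text \<open>The bound \<open>4 * real n\<close> is the full penalty in \<open>soft_max\<close>, so
  that no vertex outside the support can beat a heavy one.\<close>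

definition bounded_height :: "(int \<times> int \<Rightarrow> real) \<Rightarrow> bool" where
  "bounded_height \<phi> \<longleftrightarrow> (\<forall>v\<in>torus_pts n. \<forall>w\<in>torus_pts n. \<phi> v \<le> \<phi> w + 4 * real n)"

lemma soft_max_attained:
  assumes "\<mu> \<in> geom_real K" "bounded_height \<phi>"
  obtains v where "\<mu> v \<noteq> 0" "soft_max \<phi> \<mu> = \<phi> v - 4 * real n * max 0 (1 - \<mu> v / threshold)"
proof -
  let ?f = "\<lambda>v. \<phi> v - 4 * real n * max 0 (1 - \<mu> v / threshold)"
  have "torus_pts n \<noteq> {}" using n_pos by (auto simp: torus_pts_def)
  then have "soft_max \<phi> \<mu> \<in> ?f ` torus_pts n"
    unfolding soft_max_def using finite_torus_pts by (intro Max_in) auto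
  then obtain v where v: "v \<in> torus_pts n" "soft_max \<phi> \<mu> = ?f v" by blast
  obtain w where w: "w \<in> torus_pts n" "threshold < \<mu> w" using ex_heavy[OF assms(1)] .
  show thesis
  proof (cases "\<mu> v = 0")
    \<comment> \<open>A vertex of weight 0 pays the full penalty while the heavy vertex
      \<open>w\<close> pays nothing, so \<open>w\<close> attains the maximum as well.\<close>
    case True
    then have "soft_max \<phi> \<mu> \<le> \<phi> w"
      using v w assms(2) unfolding bounded_height_def by force
    moreover have "\<phi> w = ?f w" using w(2) threshold_pos by (simp add: max_def)
    ultimately have "soft_max \<phi> \<mu> = ?f w" using soft_max_ge[of w \<mu> \<phi>] w by simp
    moreover have "\<mu> w \<noteq> 0" using w(2) threshold_pos by simp
    ultimately show thesis using that by blast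
  qed (use that v in blast)
qed

lemma soft_max_le_height:
  assumes "\<mu> \<in> geom_real K" "bounded_height \<phi>"
  obtains v where "\<mu> v \<noteq> 0" "soft_max \<phi> \<mu> \<le> \<phi> v"
proof -
  obtain v where "\<mu> v \<noteq> 0" "soft_max \<phi> \<mu> = \<phi> v - 4 * real n * max 0 (1 - \<mu> v / threshold)"
    using soft_max_attained[OF assms] .
  moreover from this have "soft_max \<phi> \<mu> \<le> \<phi> v" by (simp add: mult_nonneg_nonneg)
  ultimately show thesis using that by blast
qed

text \<open>The maximum for \<phi> is attained in the support of \<mu>, where \<psi> dominates, and
  the penalty at that vertex is the same for both. Thus only heights on the support matter.\<close>

lemma soft_max_add_le:
  assumes "\<mu> \<in> geom_real K" "bounded_height \<phi>" "\<And>v. \<mu> v \<noteq> 0 \<Longrightarrow> \<phi> v + c \<le> \<psi> v"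
  shows "soft_max \<phi> \<mu> + c \<le> soft_max \<psi> \<mu>"
proof -
  obtain v where v: "\<mu> v \<noteq> 0" "soft_max \<phi> \<mu> = \<phi> v - 4 * real n * max 0 (1 - \<mu> v / threshold)"
    using soft_max_attained[OF assms(1,2)] .
  have "v \<in> torus_pts n" using v(1) geom_realD(3)[OF assms(1)] by blast
  then have "\<psi> v - 4 * real n * max 0 (1 - \<mu> v / threshold) \<le> soft_max \<psi> \<mu>"
    unfolding soft_max_def using finite_torus_pts by (intro Max_ge) auto
  then show ?thesis using v assms(3)[of v] by simp
qed

lemma soft_max_shift:
  assumes "\<mu> \<in> geom_real K" "bounded_height \<phi>" "bounded_height \<psi>"
    and "\<And>v. \<mu> v \<noteq> 0 \<Longrightarrow> \<psi> v = \<phi> v + c"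
  shows "soft_max \<psi> \<mu> = soft_max \<phi> \<mu> + c"
  using soft_max_add_le[OF assms(1,2), of c \<psi>] soft_max_add_le[OF assms(1,3), of "-c" \<phi>] assms(4)
  by force

section \<open>Midpoints of the range of a height\<close>

text \<open>The negated second term is a soft minimum, so this is the midpoint between soft minimum
  and soft maximum.\<close>

definition mid :: "(int \<times> int \<Rightarrow> real) \<Rightarrow> (int \<times> int \<Rightarrow> real) \<Rightarrow> real" where
  "mid \<phi> \<mu> = (soft_max \<phi> \<mu> - soft_max (\<lambda>v. - \<phi> v) \<mu>) / 2"

lemma bounded_height_minus: "bounded_height \<phi> \<Longrightarrow> bounded_height (\<lambda>v. - \<phi> v)"
  by (simp add: bounded_height_def) (smt (verit))

lemma mid_shift:
  assumes "\<mu> \<in> geom_real K" "bounded_height \<phi>" "bounded_height \<psi>"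
    and "\<And>v. \<mu> v \<noteq> 0 \<Longrightarrow> \<psi> v = \<phi> v + c"
  shows "mid \<psi> \<mu> = mid \<phi> \<mu> + c"
proof -
  have "soft_max (\<lambda>v. - \<psi> v) \<mu> = soft_max (\<lambda>v. - \<phi> v) \<mu> + - c"
    using assms bounded_height_minus by (intro soft_max_shift) auto
  then show ?thesis
    using soft_max_shift[OF assms] by (simp add: mid_def field_simps)
qed

text \<open>The soft range lies inside the range of \<phi> on the support, so its length is at most
  \<open>k\<close>; it contains the height of each heavy vertex, which is therefore within
  \<open>k / 2\<close> of its midpoint.\<close>

lemma mid_near:
  assumes \<mu>: "\<mu> \<in> geom_real K" and bd: "bounded_height \<phi>"
    and diam: "\<And>v w. \<mu> v \<noteq> 0 \<Longrightarrow> \<mu> w \<noteq> 0 \<Longrightarrow> \<phi> v - \<phi> w \<le> real k"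
    and v: "threshold < \<mu> v"
  shows "\<bar>mid \<phi> \<mu> - \<phi> v\<bar> \<le> real k / 2"
proof -
  obtain w where w: "\<mu> w \<noteq> 0" "soft_max \<phi> \<mu> \<le> \<phi> w" using soft_max_le_height[OF \<mu> bd] .
  obtain w' where w': "\<mu> w' \<noteq> 0" "soft_max (\<lambda>v. - \<phi> v) \<mu> \<le> - \<phi> w'"
    using soft_max_le_height[OF \<mu> bounded_height_minus[OF bd]] .
  have "\<mu> v \<noteq> 0" using v threshold_pos by simp
  then have "v \<in> torus_pts n" using geom_realD(3)[OF \<mu>] by blast
  then have "\<phi> v \<le> soft_max \<phi> \<mu>" "- \<phi> v \<le> soft_max (\<lambda>v. - \<phi> v) \<mu>"
    using soft_max_ge[of v \<mu> \<phi>] soft_max_ge[of v \<mu> "\<lambda>v. - \<phi> v"] v by auto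
  moreover have "\<bar>(M - M') / 2 - x\<bar> \<le> c / 2" if "x \<le> M" "- x \<le> M'" "M + M' \<le> c" for M M' x c :: real
    using that by (simp add: abs_le_iff field_simps)
  moreover have "soft_max \<phi> \<mu> + soft_max (\<lambda>v. - \<phi> v) \<mu> \<le> real k"
    using diam[OF w(1) w'(1)] w(2) w'(2) by linarith
  ultimately show ?thesis unfolding mid_def by blast
qed

lemma continuous_on_mid: "continuous_on S (mid \<phi>)"
  unfolding mid_def by (intro continuous_intros continuous_on_soft_max) auto

section \<open>Lifting simplices to the plane\<close>

text \<open>The representative of the class of \<open>q\<close> near \<open>v\<close>: in each
  coordinate the offset from \<open>v\<close> is the residue in a window of length \<open>n\<close>
  around 0.\<close>

definition lift :: "int \<times> int \<Rightarrow> int \<times> int \<Rightarrow> int \<times> int" where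
  "lift v q =
    (fst v + ((fst q - fst v + int n div 2) mod int n - int n div 2),
     snd v + ((snd q - snd v + int n div 2) mod int n - int n div 2))"

lemma pi_n_lift: "pi_n n (lift v q) = pi_n n q"
  unfolding pi_n_eq_iff
  by (intro exI[of _ "- ((fst q - fst v + int n div 2) div int n)"]
      exI[of _ "- ((snd q - snd v + int n div 2) div int n)"])
    (simp add: lift_def flip: minus_mult_div_eq_mod)

text \<open>Let \<open>v\<close> lie under a point \<open>q\<close> of \<sigma>. Points of \<sigma>
  differ from \<open>q\<close> by at most \<open>k < n / 2\<close> per coordinate, so centered
  residues recover these differences, and \<open>lift v\<close> reproduces \<sigma> up to the
  lattice translation taking \<open>q\<close> to \<open>v\<close>.\<close>

lemma lift_simplex:
  assumes "\<tau> \<in> K"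
  obtains \<sigma> where "\<sigma> \<in> VR UNIV l1_dist (int k)" "\<tau> = pi_n n ` \<sigma>"
    "\<And>v. v \<in> \<tau> \<Longrightarrow> \<exists>a b. \<forall>p\<in>\<sigma>. lift v (pi_n n p) = (fst p + int n * a, snd p + int n * b)"
proof -
  obtain \<sigma> where \<sigma>: "\<sigma> \<in> VR UNIV l1_dist (int k)" "\<tau> = pi_n n ` \<sigma>"
    using assms complex_generated_M_nk_iff by blast
  have "\<exists>a b. \<forall>p\<in>\<sigma>. lift v (pi_n n p) = (fst p + int n * a, snd p + int n * b)" if v: "v \<in> \<tau>" for v
  proof -
    obtain q where q: "q \<in> \<sigma>" "v = pi_n n q" using v \<sigma>(2) by blast
    then have "pi_n n v = pi_n n q" using pi_n_idem pi_n_in_torus_pts[OF n_pos] by metis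
    then obtain a b where ab: "fst v = fst q + int n * a" "snd v = snd q + int n * b"
      unfolding pi_n_eq_iff by blast
    have "lift v (pi_n n p) = (fst p + int n * a, snd p + int n * b)" if p: "p \<in> \<sigma>" for p
    proof -
      have "l1_dist p q \<le> int k" using p q \<sigma>(1) by (auto simp: VR_def)
      then have d: "\<bar>fst p - fst q\<bar> \<le> int k" "\<bar>snd p - snd q\<bar> \<le> int k"
        by (auto simp: l1_dist_def)
      have "pi_n n (pi_n n p) = pi_n n p" using pi_n_idem pi_n_in_torus_pts[OF n_pos] by metis
      then obtain c d where "fst (pi_n n p) = fst p + int n * c" "snd (pi_n n p) = snd p + int n * d"
        unfolding pi_n_eq_iff by blast
      then have "fst (pi_n n p) - fst v = (fst p - fst q) + int n * (c - a)"
        "snd (pi_n n p) - snd v = (snd p - snd q) + int n * (d - b)"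
        using ab by (simp_all add: algebra_simps)
      from mod_shift_eq_of_abs_le[OF n_gt d(1) this(1)] mod_shift_eq_of_abs_le[OF n_gt d(2) this(2)]
      show ?thesis unfolding lift_def using ab by simp
    qed
    then show ?thesis by blast
  qed
  with \<sigma> that show thesis by blast
qed

lemma lift_diameter:
  assumes "\<tau> \<in> K" "v \<in> \<tau>" "p \<in> \<tau>" "q \<in> \<tau>"
  shows "l1_dist (lift v p) (lift v q) \<le> int k"
proof -
  obtain \<sigma> where \<sigma>: "\<sigma> \<in> VR UNIV l1_dist (int k)" "\<tau> = pi_n n ` \<sigma>"
    "\<And>v. v \<in> \<tau> \<Longrightarrow> \<exists>a b. \<forall>p\<in>\<sigma>. lift v (pi_n n p) = (fst p + int n * a, snd p + int n * b)"
    using lift_simplex[OF assms(1)] by metis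
  obtain p' q' where pq: "p' \<in> \<sigma>" "q' \<in> \<sigma>" "p = pi_n n p'" "q = pi_n n q'"
    using assms \<sigma>(2) by blast
  then have "l1_dist (lift v p) (lift v q) = l1_dist p' q'"
    using \<sigma>(3)[OF assms(2)] by (auto simp: l1_dist_def)
  then show ?thesis using \<sigma>(1) pq by (auto simp: VR_def)
qed

text \<open>Both lifts are lattice translates of the same \<sigma>, hence of each other; the vector
  does not depend on \<open>q\<close>.\<close>

lemma lift_change_base:
  assumes "\<tau> \<in> K" "v \<in> \<tau>" "w \<in> \<tau>"
  obtains a b where "\<And>q. q \<in> \<tau> \<Longrightarrow> lift w q = (fst (lift v q) + int n * a, snd (lift v q) + int n * b)"
proof -
  obtain \<sigma> where \<sigma>: "\<tau> = pi_n n ` \<sigma>"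
    "\<And>v. v \<in> \<tau> \<Longrightarrow> \<exists>a b. \<forall>p\<in>\<sigma>. lift v (pi_n n p) = (fst p + int n * a, snd p + int n * b)"
    using lift_simplex[OF assms(1)] by metis
  obtain a b a' b' where
    "\<forall>p\<in>\<sigma>. lift v (pi_n n p) = (fst p + int n * a, snd p + int n * b)"
    "\<forall>p\<in>\<sigma>. lift w (pi_n n p) = (fst p + int n * a', snd p + int n * b')"
    using \<sigma>(2) assms by metis
  then have "lift w q = (fst (lift v q) + int n * (a' - a), snd (lift v q) + int n * (b' - b))"
    if "q \<in> \<tau>" for q
    using that \<sigma>(1) by (auto simp: algebra_simps)
  with that show thesis by blast
qed

text \<open>In the coordinates \<open>x + y\<close>, \<open>x - y\<close> the \<open>l\<^sup>1\<close> metric becomes the maximum metric, so a set of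
  diameter at most \<open>k\<close> lies within \<open>k / 2\<close> of the pair of midpoints of its two coordinate ranges.\<close>

definition sum_height :: "int \<times> int \<Rightarrow> int \<times> int \<Rightarrow> real" where
  "sum_height v q = of_int (fst (lift v q) + snd (lift v q))"

definition diff_height :: "int \<times> int \<Rightarrow> int \<times> int \<Rightarrow> real" where
  "diff_height v q = of_int (fst (lift v q) - snd (lift v q))"

text \<open>Each lifted coordinate ranges over \<open>n\<close> consecutive integers, so two heights
  differ by less than \<open>2 * n\<close>.\<close>

lemma bounded_height_lift: "bounded_height (sum_height v)" "bounded_height (diff_height v)"
proof -
  have m: "0 \<le> x mod int n" "x mod int n < int n" for x using n_pos by auto
  have "fst (lift v p) + snd (lift v p) \<le> fst (lift v q) + snd (lift v q) + 4 * int n"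
    "fst (lift v p) - snd (lift v p) \<le> fst (lift v q) - snd (lift v q) + 4 * int n" for p q
    using m[of "fst p - fst v + int n div 2"] m[of "snd p - snd v + int n div 2"]
      m[of "fst q - fst v + int n div 2"] m[of "snd q - snd v + int n div 2"]
    unfolding lift_def fst_conv snd_conv by linarith+
  then have "real_of_int (fst (lift v p) + snd (lift v p)) \<le> real_of_int (fst (lift v q) + snd (lift v q) + 4 * int n)"
    "real_of_int (fst (lift v p) - snd (lift v p)) \<le> real_of_int (fst (lift v q) - snd (lift v q) + 4 * int n)" for p q
    unfolding of_int_le_iff by blast+
  then show "bounded_height (sum_height v)" "bounded_height (diff_height v)"
    by (simp_all add: bounded_height_def sum_height_def diff_height_def)
qed

section \<open>The map from the realization to the torus\<close>

text \<open>Halving the sum and the difference converts the midpoint from the coordinates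
  \<open>x + y\<close>, \<open>x - y\<close> back to \<open>x\<close>, \<open>y\<close>;
  \<open>circ\<close> then projects it to the torus.\<close>

definition center_from :: "int \<times> int \<Rightarrow> (int \<times> int \<Rightarrow> real) \<Rightarrow> complex \<times> complex" where
  "center_from v \<mu> =
    (circ n ((mid (sum_height v) \<mu> + mid (diff_height v) \<mu>) / 2),
     circ n ((mid (sum_height v) \<mu> - mid (diff_height v) \<mu>) / 2))"

lemma continuous_on_center_from: "continuous_on S (center_from v)"
  unfolding center_from_def circ_def
  using n_pos by (intro continuous_intros continuous_on_mid) auto

text \<open>A new base translates the lifted support by \<open>n\<close> times
  \<open>(a, b)\<close>. The two midpoints move by \<open>n\<close> times \<open>a + b\<close> and
  \<open>a - b\<close>, so \<open>x\<close> and \<open>y\<close> move by whole periods, which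
  \<open>circ\<close> ignores.\<close>

lemma center_from_change_base:
  assumes \<mu>: "\<mu> \<in> geom_real K" and "\<mu> v \<noteq> 0" "\<mu> w \<noteq> 0"
  shows "center_from w \<mu> = center_from v \<mu>"
proof -
  obtain a b where ab: "\<And>q. \<mu> q \<noteq> 0 \<Longrightarrow>
      lift w q = (fst (lift v q) + int n * a, snd (lift v q) + int n * b)"
    using lift_change_base[OF geom_realD(2)[OF \<mu>], of v w] assms(2,3) by auto
  have "mid (sum_height w) \<mu> = mid (sum_height v) \<mu> + real n * of_int (a + b)"
    "mid (diff_height w) \<mu> = mid (diff_height v) \<mu> + real n * of_int (a - b)"
    by (rule mid_shift[OF \<mu> bounded_height_lift(1) bounded_height_lift(1)],
        simp add: sum_height_def ab algebra_simps)
      (rule mid_shift[OF \<mu> bounded_height_lift(2) bounded_height_lift(2)],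
        simp add: diff_height_def ab algebra_simps)
  then have "(mid (sum_height w) \<mu> + mid (diff_height w) \<mu>) / 2
      = (mid (sum_height v) \<mu> + mid (diff_height v) \<mu>) / 2 + real n * of_int a"
    "(mid (sum_height w) \<mu> - mid (diff_height w) \<mu>) / 2
      = (mid (sum_height v) \<mu> - mid (diff_height v) \<mu>) / 2 + real n * of_int b"
    by (simp_all add: field_simps)
  then show ?thesis unfolding center_from_def by (simp only: circ_shift[OF n_pos])
qed

text \<open>The choice is harmless by \<open>center_from_change_base\<close>: every vertex of the
  support gives the same value.\<close>

definition center :: "(int \<times> int \<Rightarrow> real) \<Rightarrow> complex \<times> complex" where
  "center \<mu> = center_from (SOME v. \<mu> v \<noteq> 0) \<mu>"

lemma center_eq: "\<mu> \<in> geom_real K \<Longrightarrow> \<mu> v \<noteq> 0 \<Longrightarrow> center \<mu> = center_from v \<mu>"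
  unfolding center_def by (metis (mono_tags, lifting) center_from_change_base someI)

lemma center_in_torus: "center \<mu> \<in> sphere 0 1 \<times> sphere 0 1"
  by (simp add: center_def center_from_def circ_def)

text \<open>A vertex of positive weight keeps nonzero weight nearby, so locally
  \<open>center\<close> agrees with \<open>center_from v\<close> for one fixed
  \<open>v\<close>.\<close>

lemma continuous_on_center: "continuous_on (geom_real K) center"
  unfolding continuous_on_def
proof
  fix \<mu> assume \<mu>: "\<mu> \<in> geom_real K"
  obtain v where v: "\<mu> v \<noteq> 0" using geom_realD(4)[OF \<mu>] by blast
  have "((\<lambda>f. f v) \<longlongrightarrow> \<mu> v) (at \<mu> within geom_real K)"
    using continuous_on_apply[of "geom_real K" v] \<mu> by (simp add: continuous_on_def)
  then have "\<forall>\<^sub>F f in at \<mu> within geom_real K. f v \<noteq> 0"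
    using v by (rule tendsto_imp_eventually_ne)
  moreover have "\<forall>\<^sub>F f in at \<mu> within geom_real K. f \<in> geom_real K"
    by (simp add: eventually_at_filter)
  ultimately have "\<forall>\<^sub>F f in at \<mu> within geom_real K. center_from v f = center f"
    by eventually_elim (simp add: center_eq)
  moreover have "(center_from v \<longlongrightarrow> center \<mu>) (at \<mu> within geom_real K)"
    using continuous_on_center_from[of "geom_real K" v] \<mu> v by (simp add: continuous_on_def center_eq)
  ultimately show "(center \<longlongrightarrow> center \<mu>) (at \<mu> within geom_real K)"
    by (rule Lim_transform_eventually[rotated])
qed

lemma support_truncate_subset_box:
  assumes \<mu>: "\<mu> \<in> geom_real K"
  shows "{v. truncate \<mu> v \<noteq> 0} \<subseteq> box (center \<mu>)"
proof
  fix q assume "q \<in> {v. truncate \<mu> v \<noteq> 0}"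
  then have q: "threshold < \<mu> q" using support_truncate[OF \<mu>] by blast
  then have q_supp: "\<mu> q \<noteq> 0" using threshold_pos by simp
  obtain v where v: "\<mu> v \<noteq> 0" using q_supp by blast
  have diam: "l1_dist (lift v x) (lift v y) \<le> int k" if "\<mu> x \<noteq> 0" "\<mu> y \<noteq> 0" for x y
    using lift_diameter[OF geom_realD(2)[OF \<mu>]] v that by blast
  have "sum_height v x - sum_height v y \<le> real k" "diff_height v x - diff_height v y \<le> real k"
    if "\<mu> x \<noteq> 0" "\<mu> y \<noteq> 0" for x y
    using diam[OF that] unfolding sum_height_def diff_height_def l1_dist_def by linarith+
  then have near: "\<bar>mid (sum_height v) \<mu> - sum_height v q\<bar> \<le> real k / 2"
    "\<bar>mid (diff_height v) \<mu> - diff_height v q\<bar> \<le> real k / 2"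
    using mid_near[OF \<mu> bounded_height_lift(1) _ q] mid_near[OF \<mu> bounded_height_lift(2) _ q] by blast+
  have "\<bar>(mid (sum_height v) \<mu> + mid (diff_height v) \<mu>) / 2 - of_int (fst (lift v q))\<bar>
      + \<bar>(mid (sum_height v) \<mu> - mid (diff_height v) \<mu>) / 2 - of_int (snd (lift v q))\<bar> < radius"
  proof -
    \<comment> \<open>The identity |u| + |w| = max |u + w| |u - w|, turning the two midpoint
      estimates into an \<open>l1\<close> bound of \<open>k / 2\<close>, which is below
      \<open>radius\<close>.\<close>
    have "\<bar>(S + D) / 2 - x\<bar> + \<bar>(S - D) / 2 - y\<bar> \<le> c"
      if "\<bar>S - (x + y)\<bar> \<le> c" "\<bar>D - (x - y)\<bar> \<le> c" for S D x y c :: real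
      using that by (auto simp: abs_if field_simps split: if_splits)
    from this[of "mid (sum_height v) \<mu>" _ _ _ "mid (diff_height v) \<mu>"] near show ?thesis
      unfolding radius_def sum_height_def diff_height_def of_int_add of_int_diff by fastforce
  qed
  moreover have "q \<in> torus_pts n" using geom_realD(3)[OF \<mu>] q_supp by blast
  then have "pi_n n (lift v q) = q" by (simp add: pi_n_lift pi_n_idem)
  ultimately have "q \<in> box (center_from v \<mu>)"
    unfolding center_from_def box_circ by (intro image_eqI[of _ _ "lift v q"]) auto
  then show "q \<in> box (center \<mu>)" using center_eq[OF \<mu> v] by simp
qed

section \<open>The two composites are homotopic to the identities\<close>

lemma homotopic_truncate_spread_center:
  "homotopic_with_canon (\<lambda>_. True) (geom_real K) (geom_real K) truncate (spread \<circ> center)"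
proof (rule homotopic_with_contiguous)
  show "continuous_on (geom_real K) (spread \<circ> center)"
    using center_in_torus
    by (intro continuous_on_compose continuous_on_center continuous_on_subset[OF continuous_on_spread]) blast
  show "\<exists>\<tau>\<in>K. {v. truncate \<mu> v \<noteq> 0} \<subseteq> \<tau> \<and> {v. (spread \<circ> center) \<mu> v \<noteq> 0} \<subseteq> \<tau>"
    if "\<mu> \<in> geom_real K" for \<mu>
    using support_truncate_subset_box[OF that] box_in_K[OF center_in_torus]
      support_spread[OF center_in_torus] by (intro bexI[of _ "box (center \<mu>)"]) auto
qed (use center_in_torus continuous_on_truncate truncate_in_geom_real spread_in_geom_real in auto)

lemma homotopic_center_spread_id:
  "homotopic_with_canon (\<lambda>_. True) (sphere 0 1 \<times> sphere 0 1) (sphere 0 1 \<times> sphere 0 1)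
     (center \<circ> spread) id"
proof -
  let ?T = "sphere (0::complex) 1 \<times> sphere (0::complex) 1"
  have cont: "continuous_on ?T (center \<circ> spread)"
    using spread_in_geom_real
    by (intro continuous_on_compose continuous_on_spread continuous_on_subset[OF continuous_on_center]) blast
  have ne: "fst (center (spread z)) \<noteq> - fst z" "snd (center (spread z)) \<noteq> - snd z" if z: "z \<in> ?T" for z
  proof -
    note \<mu> = spread_in_geom_real[OF z]
    \<comment> \<open>A heavy vertex of \<open>spread z\<close> survives truncation, so it lies in
      the box of the center; being in the support of \<open>spread z\<close>, it also lies in
      \<open>box z\<close>.\<close>
    obtain v where v: "threshold < spread z v" using ex_heavy[OF \<mu>] by blast
    then have "v \<in> box (center (spread z))"
      using support_truncate_subset_box[OF \<mu>] support_truncate[OF \<mu>] by blast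
    moreover have "v \<in> box z"
      using support_spread[OF z] v threshold_pos by force
    ultimately show "fst (center (spread z)) \<noteq> - fst z" "snd (center (spread z)) \<noteq> - snd z"
      using not_antipodal_of_common_box[OF _ _ center_in_torus z] by blast+
  qed
  have "homotopic_with_canon (\<lambda>_. True) ?T ?T
      (\<lambda>z. (fst (center (spread z)), snd (center (spread z)))) (\<lambda>z. (fst z, snd z))"
    using cont center_in_torus ne
    by (intro homotopic_with_canon_Pair homotopic_with_sphere_non_antipodal)
      (auto intro!: continuous_intros simp: comp_def mem_Times_iff)
  then show ?thesis by (simp add: comp_def id_def)
qed

theorem realization_homotopy_equivalent_torus:
  "realization K homotopy_equivalent_space torus_space"
  unfolding homotopy_equivalent_space_def realization_def torus_space_def
    prod_topology_subtopology_eu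
proof (intro exI conjI)
  let ?T = "sphere (0::complex) 1 \<times> sphere (0::complex) 1"
  show "continuous_map (top_of_set (geom_real K)) (top_of_set ?T) center"
    using continuous_on_center center_in_torus by auto
  show "continuous_map (top_of_set ?T) (top_of_set (geom_real K)) spread"
    using continuous_on_spread spread_in_geom_real by auto
  show "homotopic_with_canon (\<lambda>_. True) (geom_real K) (geom_real K) (spread \<circ> center) id"
    using homotopic_with_trans[OF homotopic_id_truncate homotopic_truncate_spread_center]
    by (rule homotopic_with_symD)
  show "homotopic_with_canon (\<lambda>_. True) ?T ?T (center \<circ> spread) id"
    by (rule homotopic_center_spread_id)
qed

section \<open>Identification with the Vietoris-Rips complex of the torus grid\<close>

lemma torus_dist_pi_n_le: "torus_dist n (pi_n n p) (pi_n n q) \<le> l1_dist p q"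
proof -
  have "min \<bar>x mod int n - y mod int n\<bar> (int n - \<bar>x mod int n - y mod int n\<bar>) \<le> \<bar>x - y\<bar>" for x y
  proof -
    have b: "0 \<le> x mod int n" "x mod int n < int n" "0 \<le> y mod int n" "y mod int n < int n"
      using n_pos by auto
    define m where "m = x div int n - y div int n"
    have e: "x - y = (x mod int n - y mod int n) + int n * m"
      unfolding m_def using mult_div_mod_eq[of "int n" x] mult_div_mod_eq[of "int n" y]
      by (simp add: algebra_simps)
    \<comment> \<open>For nonzero \<open>m\<close>, \<open>x - y\<close> is the difference d of the
      residues moved by at least one period, and |d| < n, so its absolute value is at least n -
      |d|.\<close>
    consider "m = 0" | "m \<ge> 1" | "m \<le> -1" by linarith
    then show ?thesis
    proof cases
      case 2
      then have "int n * 1 \<le> int n * m" using n_pos by (intro mult_left_mono) auto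
      then show ?thesis using e b by linarith
    next
      case 3
      then have "int n * m \<le> int n * (-1)" using n_pos by (intro mult_left_mono) auto
      then show ?thesis using e b by linarith
    qed (use e in simp)
  qed
  then show ?thesis unfolding torus_dist_def l1_dist_def pi_n_def fst_conv snd_conv
    by (intro add_mono)
qed

lemma torus_dist_attained:
  assumes "p \<in> torus_pts n" "q \<in> torus_pts n"
  obtains a b where "torus_dist n p q = l1_dist p (fst q + int n * a, snd q + int n * b)"
proof -
  have "\<exists>m. min \<bar>x - y\<bar> (int n - \<bar>x - y\<bar>) = \<bar>x - (y + int n * m)\<bar>"
    if "0 \<le> x" "x < int n" "0 \<le> y" "y < int n" for x y
  proof -
    \<comment> \<open>If the way around the circle is shorter, moving \<open>y\<close> by one period
      to the other side of \<open>x\<close> realizes it.\<close>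
    consider "2 * \<bar>x - y\<bar> \<le> int n" | "2 * \<bar>x - y\<bar> > int n" "x \<ge> y" | "2 * \<bar>x - y\<bar> > int n" "x < y"
      by linarith
    then show ?thesis
    proof cases
      case 1 then show ?thesis by (intro exI[of _ 0]) auto
    next
      case 2 then show ?thesis using that by (intro exI[of _ 1]) auto
    next
      case 3 then show ?thesis using that by (intro exI[of _ "-1"]) auto
    qed
  qed
  note * = this
  obtain a where "min \<bar>fst p - fst q\<bar> (int n - \<bar>fst p - fst q\<bar>) = \<bar>fst p - (fst q + int n * a)\<bar>"
    using *[of "fst p" "fst q"] assms by (auto simp: torus_pts_def)
  moreover obtain b where "min \<bar>snd p - snd q\<bar> (int n - \<bar>snd p - snd q\<bar>) = \<bar>snd p - (snd q + int n * b)\<bar>"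
    using *[of "snd p" "snd q"] assms by (auto simp: torus_pts_def)
  ultimately show thesis using that[of a b] by (simp add: torus_dist_def l1_dist_def)
qed

text \<open>Projection does not increase distances, which gives one inclusion. For the other, lift
  all vertices to within \<open>k\<close> of a base \<open>v\<close>. For two of them, the failure
  of a short edge to lift compatibly is a lattice vector of \<open>l1\<close> length at most
  \<open>3 * k < n\<close>, hence zero.\<close>

lemma VR_torus_eq_K:
  assumes "3 * k < n"
  shows "VR (torus_pts n) (torus_dist n) (int k) = K"
proof (intro equalityI subsetI)
  fix \<tau> assume "\<tau> \<in> K"
  then obtain \<sigma> where \<sigma>: "\<sigma> \<in> VR UNIV l1_dist (int k)" "\<tau> = pi_n n ` \<sigma>"
    unfolding complex_generated_M_nk_iff by blast
  then show "\<tau> \<in> VR (torus_pts n) (torus_dist n) (int k)"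
    using pi_n_in_torus_pts[OF n_pos] order_trans[OF torus_dist_pi_n_le]
    unfolding VR_def mem_Collect_eq by (simp add: image_subset_iff)
next
  fix \<tau> assume \<tau>: "\<tau> \<in> VR (torus_pts n) (torus_dist n) (int k)"
  then obtain v where v: "v \<in> \<tau>" by (auto simp: VR_def)
  have T: "q \<in> torus_pts n" if "q \<in> \<tau>" for q using \<tau> that by (auto simp: VR_def)
  have near: "\<exists>q'. pi_n n q' = q \<and> l1_dist v q' \<le> int k" if q: "q \<in> \<tau>" for q
  proof -
    obtain a b where ab: "torus_dist n v q = l1_dist v (fst q + int n * a, snd q + int n * b)"
      using torus_dist_attained[OF T[OF v] T[OF q]] .
    moreover have "torus_dist n v q \<le> int k" using \<tau> v q by (auto simp: VR_def)
    moreover have "pi_n n (fst q + int n * a, snd q + int n * b) = q"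
      using pi_n_idem[OF T[OF q]] by (simp add: pi_n_def)
    ultimately show ?thesis by metis
  qed
  then obtain l where l: "\<And>q. q \<in> \<tau> \<Longrightarrow> pi_n n (l q) = q" "\<And>q. q \<in> \<tau> \<Longrightarrow> l1_dist v (l q) \<le> int k"
    by metis
  have "l1_dist (l p) (l q) \<le> int k" if pq: "p \<in> \<tau>" "q \<in> \<tau>" for p q
  proof -
    obtain a b where ab: "torus_dist n p q = l1_dist p (fst q + int n * a, snd q + int n * b)"
      using torus_dist_attained[OF T[OF pq(1)] T[OF pq(2)]] .
    have le: "l1_dist p (fst q + int n * a, snd q + int n * b) \<le> int k"
      using \<tau> pq unfolding ab[symmetric] by (simp add: VR_def)
    have "pi_n n (l p) = pi_n n p" "pi_n n (l q) = pi_n n q"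
      using l(1) pq pi_n_idem T by metis+
    then obtain c d c' d' where cd: "fst (l p) = fst p + int n * c" "snd (l p) = snd p + int n * d"
        "fst (l q) = fst q + int n * c'" "snd (l q) = snd q + int n * d'"
      unfolding pi_n_eq_iff by blast
    \<comment> \<open>The vector is the total displacement along three steps of length at most
      \<open>k\<close>: from \<open>v\<close> to \<open>l p\<close>, from \<open>p\<close> to the
      translate of \<open>q\<close> nearest to it, and from \<open>l q\<close> back to
      \<open>v\<close>.\<close>
    have tri: "\<bar>int n * (c - c' + a)\<bar> + \<bar>int n * (d - d' + b)\<bar> \<le> 3 * int k"
    proof -
      have "l1_dist p q' \<le> int k \<Longrightarrow> l1_dist v p' \<le> int k \<Longrightarrow> l1_dist v r' \<le> int k
        \<Longrightarrow> \<bar>fst p' - fst p - (fst r' - fst q')\<bar> + \<bar>snd p' - snd p - (snd r' - snd q')\<bar> \<le> 3 * int k"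
        for q' p' r' unfolding l1_dist_def by linarith
      from this[OF le l(2)[OF pq(1)] l(2)[OF pq(2)]] show ?thesis
        by (simp add: cd algebra_simps)
    qed
    have "m = 0" if "\<bar>int n * m\<bar> \<le> 3 * int k" for m
    proof (rule ccontr)
      assume "m \<noteq> 0"
      then have "int n * 1 \<le> int n * \<bar>m\<bar>" by (intro mult_left_mono) auto
      with that assms show False by (simp add: abs_mult)
    qed
    then have "c - c' + a = 0" "d - d' + b = 0" using tri by (smt (verit))+
    then have "c' = c + a" "d' = d + b" by auto
    with cd have "l1_dist (l p) (l q) = l1_dist p (fst q + int n * a, snd q + int n * b)"
      by (simp add: l1_dist_def algebra_simps)
    with le show ?thesis by simp
  qed
  then have "l ` \<tau> \<in> VR UNIV l1_dist (int k)" using \<tau> by (auto simp: VR_def)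
  moreover have "\<tau> = pi_n n ` l ` \<tau>" using l(1) by force
  ultimately show "\<tau> \<in> K" unfolding complex_generated_M_nk_iff by blast
qed

end

theorem theorem5p8:
  fixes n k :: nat
  assumes "k \<ge> 2"
  shows "(n > 2 * k \<longrightarrow>
           realization (complex_generated (M_nk n k)) homotopy_equivalent_space torus_space)
       \<and> (n > 3 * k \<longrightarrow>
           realization (VR (torus_pts n) (torus_dist n) (int k)) homotopy_equivalent_space torus_space)"
proof (intro conjI impI)
  assume "n > 2 * k"
  with assms interpret torus_grid n k by unfold_locales
  show "realization (complex_generated (M_nk n k)) homotopy_equivalent_space torus_space"
    by (rule realization_homotopy_equivalent_torus)
next
  assume n: "n > 3 * k"
  with assms interpret torus_grid n k by unfold_locales auto
  show "realization (VR (torus_pts n) (torus_dist n) (int k)) homotopy_equivalent_space torus_space"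
    unfolding VR_torus_eq_K[OF n] by (rule realization_homotopy_equivalent_torus)
qed

end
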